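(* Let $(M,* )$ be a Maltsev algebra and $\rho$ a representation of $(M,* )$. Then $\rho$ induces a representation of the Bol algebra $(M,*,[\,,\,,\,])$ associated with $(M,* )$.
   Context: All vector spaces and algebras are finite-dimensional over a field $\mathbb{K}$ of characteristic zero. In $\mathrm{End}(V)$, the space of all endomorphisms of a vector space $V$, juxtaposition is composition and $[f,g]=fg-gf$. A Maltsev algebra is a vector space $M$ with a bilinear operation $*$ such that $x*y=-y*x$ and $(x*y)*(x*z) = ((x*y)*z)*x + ((y*z)*x)*x + ((z*x)*x)*y$ for all $x,y,z\in M$. A representation of a Maltsev algebra $(M,* )$ on a vector space $V$ is a linear map $\rho: M\to \mathrm{End}(V)$ satisfying, for all $x,y,z\in M$, either of the following two conditions, which are known to be equivalent: (1) $\rho(x*(y*z)) - \rho(z)\{\rho(x),\rho(y)\} + \rho(y)\{\rho(x),\rho(z)\} = \{\rho(x),\rho(y*z)\} - \rho(z)\rho(x*y) + \rho(y)\rho(x*z)$, where $\{f,g\}=fg+gf$; (2) $\big[[\rho(x),\rho(y)]+\rho(x*y),\ \rho(z)\big] = \rho\big(x*(y*z)-y*(x*z)+(x*y)*z\big)$. A Bol algebra is a triple $(B,*,[\,,\,,\,])$ with $B$ a vector space, $*$ a bilinear operation and $[\,,\,,\,]$ a trilinear operation on $B$ such that for all $u,v,w,x,y,z\in B$: (B01) $x*y=-y*x$; (B02) $[x,y,z]=-[y,x,z]$; (B1) $[x,y,z]+[y,z,x]+[z,x,y]=0$; (B2) $[x,y,u*v]=[x,y,u]*v+u*[x,y,v]+[u,v,x*y]-(u*v)*(x*y)$;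 (B3) $[x,y,[u,v,w]]=[[x,y,u],v,w]+[u,[x,y,v],w]+[u,v,[x,y,w]]$. The Bol algebra associated with a Maltsev algebra $(M,* )$ is $(M,*,[\,,\,,\,])$ with $[x,y,z] := \frac{1}{3}\big(x*(y*z) - y*(x*z) + 2(x*y)*z\big)$; it is known that this is a Bol algebra. A representation of a Bol algebra $B$ in a vector space $V$ is a triple $(\rho,D,\theta)$ with $\rho:B\to\mathrm{End}(V)$ linear and $D,\theta:B\times B\to \mathrm{End}(V)$ bilinear such that for all $x_i,y_i\in B$: (R1) $D(x_1,x_2)+\theta(x_1,x_2)-\theta(x_2,x_1)=0$; (R21) $[D(x_1,x_2),\rho(y_1)]=\rho([x_1,x_2,y_1])-\theta(y_1,x_1*x_2)+\rho(x_1*x_2)\rho(y_1)$; (R22) $\theta(x_1,y_1*y_2)=\rho(y_1)\theta(x_1,y_2)-\rho(y_2)\theta(x_1,y_1)-\big(D(y_1,y_2)-\rho(y_1*y_2)\big)\rho(x_1)$; (R31) $[D(x_1,x_2),D(y_1,y_2)]=D([x_1,x_2,y_1],y_2)+D(y_1,[x_1,x_2,y_2])$; (R32) $[D(x_1,x_2),\theta(y_1,y_2)]=\theta([x_1,x_2,y_1],y_2)+\theta(y_1,[x_1,x_2,y_2])$; (R33) $\theta(x_1,[y_1,y_2,y_3])=\theta(y_2,y_3)\theta(x_1,y_1)-\theta(y_1,y_3)\theta(x_1,y_2)+D(y_1,y_2)\theta(x_1,y_3)$.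
   Formalization: A representation of a Maltsev algebra is required to satisfy both conditions (1) and (2), since these are not equivalent as stated and the induced (R21) and (R22) amount exactly to (2) and (1); the induced D and θ are given explicitly. *)

theory Defs
  imports Complex_Main "HOL-Library.Function_Algebras" "HOL-Library.Product_Plus"
begin

text \<open>
  Vector spaces are given by a scalar multiplication on a type of class \<open>ab_group_add\<close>, as in
  the locale \<open>vector_space\<close>. An endomorphism of \<open>V\<close> is a function \<open>'v \<Rightarrow> 'v\<close> that is linear;
  sums and differences of endomorphisms are the pointwise ones of \<open>Function_Algebras\<close>, and
  juxtaposition is \<open>\<circ>\<close> (the pointwise product of functions in that theory is never used).
\<close>

definition finite_dim :: "('k::field \<Rightarrow> 'a::ab_group_add \<Rightarrow> 'a) \<Rightarrow> bool" where
  "finite_dim scale \<longleftrightarrow> (\<exists>Basis. finite_dimensional_vector_space scale Basis)"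

definition End_scale :: "('k \<Rightarrow> 'v \<Rightarrow> 'v) \<Rightarrow> 'k \<Rightarrow> ('v \<Rightarrow> 'v) \<Rightarrow> 'v \<Rightarrow> 'v" where
  "End_scale scale c f = (\<lambda>v. scale c (f v))"

definition End :: "('k::field \<Rightarrow> 'v::ab_group_add \<Rightarrow> 'v) \<Rightarrow> ('v \<Rightarrow> 'v) set" where
  "End scale = {f. Vector_Spaces.linear scale scale f}"

definition commutator :: "('v \<Rightarrow> 'v) \<Rightarrow> ('v \<Rightarrow> 'v) \<Rightarrow> 'v \<Rightarrow> 'v::ab_group_add" where
  "commutator f g = (f \<circ> g) - (g \<circ> f)"

definition anticommutator :: "('v \<Rightarrow> 'v) \<Rightarrow> ('v \<Rightarrow> 'v) \<Rightarrow> 'v \<Rightarrow> 'v::ab_group_add" where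
  "anticommutator f g = (f \<circ> g) + (g \<circ> f)"

definition bilinear_map ::
    "('k::field \<Rightarrow> 'a::ab_group_add \<Rightarrow> 'a) \<Rightarrow> ('k \<Rightarrow> 'b::ab_group_add \<Rightarrow> 'b) \<Rightarrow>
     ('k \<Rightarrow> 'c::ab_group_add \<Rightarrow> 'c) \<Rightarrow> ('a \<Rightarrow> 'b \<Rightarrow> 'c) \<Rightarrow> bool" where
  "bilinear_map sA sB sC f \<longleftrightarrow>
     (\<forall>x. Vector_Spaces.linear sB sC (f x)) \<and>
     (\<forall>y. Vector_Spaces.linear sA sC (\<lambda>x. f x y))"

definition trilinear_op ::
    "('k::field \<Rightarrow> 'a::ab_group_add \<Rightarrow> 'a) \<Rightarrow> ('a \<Rightarrow> 'a \<Rightarrow> 'a \<Rightarrow> 'a) \<Rightarrow> bool" where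
  "trilinear_op s f \<longleftrightarrow>
     (\<forall>y z. Vector_Spaces.linear s s (\<lambda>x. f x y z)) \<and>
     (\<forall>x z. Vector_Spaces.linear s s (\<lambda>y. f x y z)) \<and>
     (\<forall>x y. Vector_Spaces.linear s s (\<lambda>z. f x y z))"

locale maltsev_algebra =
  fixes scale :: "'k::field_char_0 \<Rightarrow> 'm::ab_group_add \<Rightarrow> 'm"
    and mul :: "'m \<Rightarrow> 'm \<Rightarrow> 'm" (infixl "\<star>" 70)
  assumes finite_dim: "finite_dim scale"
    and bilinear: "bilinear_map scale scale scale (\<star>)"
    and anticommutative: "x \<star> y = - (y \<star> x)"
    and maltsev_identity:
      "(x \<star> y) \<star> (x \<star> z)
         = ((x \<star> y) \<star> z) \<star> x + ((y \<star> z) \<star> x) \<star> x + ((z \<star> x) \<star> x) \<star> y"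

locale bol_algebra =
  fixes scale :: "'k::field_char_0 \<Rightarrow> 'b::ab_group_add \<Rightarrow> 'b"
    and mul :: "'b \<Rightarrow> 'b \<Rightarrow> 'b" (infixl "\<star>" 70)
    and br :: "'b \<Rightarrow> 'b \<Rightarrow> 'b \<Rightarrow> 'b"
  assumes finite_dim: "finite_dim scale"
    and bilinear: "bilinear_map scale scale scale (\<star>)"
    and trilinear: "trilinear_op scale br"
    and B01: "x \<star> y = - (y \<star> x)"
    and B02: "br x y z = - br y x z"
    and B1: "br x y z + br y z x + br z x y = 0"
    and B2: "br x y (u \<star> v)
               = br x y u \<star> v + u \<star> br x y v + br u v (x \<star> y) - (u \<star> v) \<star> (x \<star> y)"
    and B3: "br x y (br u v w) = br (br x y u) v w + br u (br x y v) w + br u v (br x y w)"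

text \<open>
  Conditions (1) and (2) below are often quoted as equivalent definitions of a representation of a
  Maltsev algebra. For arbitrary linear \<open>\<rho>\<close> neither implies the other, already for
  the plane \<open>M\<close> with basis \<open>a, b\<close> and zero product:

  \<^item> \<open>\<rho> a = diag(1, -2)\<close>, \<open>\<rho> b = E\<^sub>2\<^sub>1\<close> on \<open>K\<^sup>2\<close> satisfies (1) but not (2);
  \<^item> \<open>\<rho> a = I + E\<^sub>1\<^sub>2\<close>, \<open>\<rho> b = E\<^sub>2\<^sub>3\<close> on \<open>K\<^sup>3\<close> satisfies (2) but not (1).

  A representation is therefore required to satisfy both conditions. For linear \<open>\<rho>\<close> on a Maltsev
  algebra they together say exactly that
  the split null extension \<open>M \<oplus> V\<close>, with \<open>(x, u) \<star> (y, v) = (x \<star> y, \<rho> x v - \<rho> y u)\<close>, satisfies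
  the Maltsev identity. Under only one of them the induced maps defined
  below need not satisfy (R21), respectively (R22), as the same examples show.
\<close>

definition maltsev_rep_cond1 :: "('m \<Rightarrow> 'm \<Rightarrow> 'm) \<Rightarrow> ('m \<Rightarrow> 'v \<Rightarrow> 'v::ab_group_add) \<Rightarrow> bool" where
  "maltsev_rep_cond1 mul \<rho> \<longleftrightarrow> (\<forall>x y z.
     \<rho> (mul x (mul y z)) - (\<rho> z \<circ> anticommutator (\<rho> x) (\<rho> y))
         + (\<rho> y \<circ> anticommutator (\<rho> x) (\<rho> z))
       = anticommutator (\<rho> x) (\<rho> (mul y z)) - (\<rho> z \<circ> \<rho> (mul x y)) + (\<rho> y \<circ> \<rho> (mul x z)))"

definition maltsev_rep_cond2 ::
    "('m \<Rightarrow> 'm \<Rightarrow> 'm::ab_group_add) \<Rightarrow> ('m \<Rightarrow> 'v \<Rightarrow> 'v::ab_group_add) \<Rightarrow> bool" where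
  "maltsev_rep_cond2 mul \<rho> \<longleftrightarrow> (\<forall>x y z.
     commutator (commutator (\<rho> x) (\<rho> y) + \<rho> (mul x y)) (\<rho> z)
       = \<rho> (mul x (mul y z) - mul y (mul x z) + mul (mul x y) z))"

locale maltsev_representation = maltsev_algebra scaleM mul
  for scaleM :: "'k::field_char_0 \<Rightarrow> 'm::ab_group_add \<Rightarrow> 'm"
    and mul :: "'m \<Rightarrow> 'm \<Rightarrow> 'm" (infixl "\<star>" 70) +
  fixes scaleV :: "'k \<Rightarrow> 'v::ab_group_add \<Rightarrow> 'v"
    and \<rho> :: "'m \<Rightarrow> 'v \<Rightarrow> 'v"
  assumes finite_dimV: "finite_dim scaleV"
    and rho_End: "\<rho> x \<in> End scaleV"
    and rho_linear: "Vector_Spaces.linear scaleM (End_scale scaleV) \<rho>"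
    and cond1: "maltsev_rep_cond1 (\<star>) \<rho>"
    and cond2: "maltsev_rep_cond2 (\<star>) \<rho>"

locale bol_representation = bol_algebra scaleB mul br
  for scaleB :: "'k::field_char_0 \<Rightarrow> 'b::ab_group_add \<Rightarrow> 'b"
    and mul :: "'b \<Rightarrow> 'b \<Rightarrow> 'b" (infixl "\<star>" 70)
    and br :: "'b \<Rightarrow> 'b \<Rightarrow> 'b \<Rightarrow> 'b" +
  fixes scaleV :: "'k \<Rightarrow> 'v::ab_group_add \<Rightarrow> 'v"
    and \<rho> :: "'b \<Rightarrow> 'v \<Rightarrow> 'v"
    and D \<theta> :: "'b \<Rightarrow> 'b \<Rightarrow> 'v \<Rightarrow> 'v"
  assumes finite_dimV: "finite_dim scaleV"
    and rho_End: "\<rho> x \<in> End scaleV"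
    and D_End: "D x y \<in> End scaleV"
    and theta_End: "\<theta> x y \<in> End scaleV"
    and rho_linear: "Vector_Spaces.linear scaleB (End_scale scaleV) \<rho>"
    and D_bilinear: "bilinear_map scaleB scaleB (End_scale scaleV) D"
    and theta_bilinear: "bilinear_map scaleB scaleB (End_scale scaleV) \<theta>"
    and R1: "D x1 x2 + \<theta> x1 x2 - \<theta> x2 x1 = 0"
    and R21: "commutator (D x1 x2) (\<rho> y1)
                = \<rho> (br x1 x2 y1) - \<theta> y1 (x1 \<star> x2) + (\<rho> (x1 \<star> x2) \<circ> \<rho> y1)"
    and R22: "\<theta> x1 (y1 \<star> y2)
                = (\<rho> y1 \<circ> \<theta> x1 y2) - (\<rho> y2 \<circ> \<theta> x1 y1) - ((D y1 y2 - \<rho> (y1 \<star> y2)) \<circ> \<rho> x1)"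
    and R31: "commutator (D x1 x2) (D y1 y2) = D (br x1 x2 y1) y2 + D y1 (br x1 x2 y2)"
    and R32: "commutator (D x1 x2) (\<theta> y1 y2) = \<theta> (br x1 x2 y1) y2 + \<theta> y1 (br x1 x2 y2)"
    and R33: "\<theta> x1 (br y1 y2 y3)
                = (\<theta> y2 y3 \<circ> \<theta> x1 y1) - (\<theta> y1 y3 \<circ> \<theta> x1 y2) + (D y1 y2 \<circ> \<theta> x1 y3)"

definition assoc_bracket ::
    "('k::field_char_0 \<Rightarrow> 'm::ab_group_add \<Rightarrow> 'm) \<Rightarrow> ('m \<Rightarrow> 'm \<Rightarrow> 'm) \<Rightarrow> 'm \<Rightarrow> 'm \<Rightarrow> 'm \<Rightarrow> 'm" where
  "assoc_bracket scale mul x y z =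
     scale (1/3) (mul x (mul y z) - mul y (mul x z) + scale 2 (mul (mul x y) z))"

text \<open>
  The induced maps come from the bracket associated with the split null extension \<open>M \<oplus> V\<close>:
  \<open>D x y v = [x, y, v]\<close> and \<open>\<theta> x y v = [v, x, y]\<close>, where \<open>x \<star> v = \<rho> x v\<close> and \<open>v \<star> x = - \<rho> x v\<close>.
  This is the correspondence under which (R21)--(R33) are the cases of (B2) and (B3) with one
  argument in \<open>V\<close>.
\<close>

definition induced_D ::
    "('k::field_char_0 \<Rightarrow> 'v::ab_group_add \<Rightarrow> 'v) \<Rightarrow> ('m \<Rightarrow> 'm \<Rightarrow> 'm) \<Rightarrow> ('m \<Rightarrow> 'v \<Rightarrow> 'v) \<Rightarrow>
     'm \<Rightarrow> 'm \<Rightarrow> 'v \<Rightarrow> 'v" where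
  "induced_D scaleV mul \<rho> x y =
     End_scale scaleV (1/3) (commutator (\<rho> x) (\<rho> y) + End_scale scaleV 2 (\<rho> (mul x y)))"

definition induced_theta ::
    "('k::field_char_0 \<Rightarrow> 'v::ab_group_add \<Rightarrow> 'v) \<Rightarrow> ('m \<Rightarrow> 'm \<Rightarrow> 'm) \<Rightarrow> ('m \<Rightarrow> 'v \<Rightarrow> 'v) \<Rightarrow>
     'm \<Rightarrow> 'm \<Rightarrow> 'v \<Rightarrow> 'v" where
  "induced_theta scaleV mul \<rho> x y =
     End_scale scaleV (1/3)
       ((\<rho> x \<circ> \<rho> y) + End_scale scaleV 2 (\<rho> y \<circ> \<rho> x) - \<rho> (mul x y))"

definition ext_scale :: "('k \<Rightarrow> 'm \<Rightarrow> 'm) \<Rightarrow> ('k \<Rightarrow> 'v \<Rightarrow> 'v) \<Rightarrow> 'k \<Rightarrow> 'm \<times> 'v \<Rightarrow> 'm \<times> 'v" where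
  "ext_scale scaleM scaleV c p = (scaleM c (fst p), scaleV c (snd p))"

definition ext_mul ::
    "('m \<Rightarrow> 'm \<Rightarrow> 'm) \<Rightarrow> ('m \<Rightarrow> 'v \<Rightarrow> 'v::ab_group_add) \<Rightarrow> 'm \<times> 'v \<Rightarrow> 'm \<times> 'v \<Rightarrow> 'm \<times> 'v" where
  "ext_mul mul \<rho> p q = (mul (fst p) (fst q), \<rho> (fst p) (snd q) - \<rho> (fst q) (snd p))"


lemma (in maltsev_representation) assoc_bracket_ext:
  defines "B \<equiv> assoc_bracket (ext_scale scaleM scaleV) (ext_mul (\<star>) \<rho>)"
  shows "B (x, 0) (y, 0) (0, v) = (0, induced_D scaleV (\<star>) \<rho> x y v)"
    and "B (0, v) (x, 0) (y, 0) = (0, induced_theta scaleV (\<star>) \<rho> x y v)"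
    and "B (x, 0) (y, 0) (z, 0) = (assoc_bracket scaleM (\<star>) x y z, 0)"
proof -
  have lin: "Vector_Spaces.linear scaleV scaleV (\<rho> x)" for x
    using rho_End[of x] by (simp add: End_def)
  have V: "vector_space scaleV"
    using lin Vector_Spaces.linear_iff by blast
  interpret V: vector_space scaleV by (rule V)
  have M: "vector_space scaleM"
    using bilinear by (auto simp: bilinear_map_def Vector_Spaces.linear_iff)
  interpret M: vector_space scaleM by (rule M)
  have add: "\<rho> x (u + w) = \<rho> x u + \<rho> x w" and scl: "\<rho> x (scaleV c u) = scaleV c (\<rho> x u)"
    for x u w c
    using lin[of x] by (auto simp: Vector_Spaces.linear_iff)
  have r0: "\<rho> x 0 = 0" for x using add[of x 0 0] by simp
  have neg: "\<rho> x (- u) = - \<rho> x u" for x u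
    using add[of x u "- u"] r0[of x] by (simp add: eq_neg_iff_add_eq_0 add.commute)
  have Z: "\<rho> 0 u = 0" for u
    using rho_linear by (auto simp: Vector_Spaces.linear_iff plus_fun_def dest!: spec[of _ 0])
      (metis add_cancel_right_right)
  have m0: "x \<star> 0 = 0" "0 \<star> x = 0" for x
  proof -
    have "x \<star> (0 + 0) = x \<star> 0 + x \<star> 0"
      using bilinear unfolding bilinear_map_def Vector_Spaces.linear_iff by blast
    then show "x \<star> 0 = 0" by simp
    then show "0 \<star> x = 0" using anticommutative[of 0 x] by simp
  qed
  note defs = B_def assoc_bracket_def ext_scale_def ext_mul_def induced_D_def induced_theta_def
    End_scale_def commutator_def minus_prod_def plus_prod_def
  show "B (x, 0) (y, 0) (0, v) = (0, induced_D scaleV (\<star>) \<rho> x y v)"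
    by (simp add: defs r0 Z m0 neg)
  show "B (0, v) (x, 0) (y, 0) = (0, induced_theta scaleV (\<star>) \<rho> x y v)"
    by (simp add: defs r0 Z m0 neg scl algebra_simps)
  show "B (x, 0) (y, 0) (z, 0) = (assoc_bracket scaleM (\<star>) x y z, 0)"
    by (simp add: defs r0 Z m0 neg)
qed

lemma maltsev_rep_cond1_not_cond2:
  defines "\<rho> \<equiv> \<lambda>(s, t) (p, q). (s * p, t * p - 2 * s * q) :: 'k::field_char_0 \<times> 'k"
  shows "maltsev_rep_cond1 (\<lambda>_ _. 0) \<rho>" and "\<not> maltsev_rep_cond2 (\<lambda>_ _. 0) \<rho>"
proof -
  show "maltsev_rep_cond1 (\<lambda>_ _. 0) \<rho>"
    unfolding maltsev_rep_cond1_def \<rho>_def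
    by (auto simp: fun_eq_iff anticommutator_def zero_prod_def algebra_simps)
  have "commutator (commutator (\<rho> (1, 0)) (\<rho> (0, 1)) + \<rho> 0) (\<rho> (1, 0)) (1, 0) \<noteq> \<rho> 0 (1, 0)"
    by (simp add: \<rho>_def commutator_def zero_prod_def)
  then show "\<not> maltsev_rep_cond2 (\<lambda>_ _. 0) \<rho>"
    unfolding maltsev_rep_cond2_def by (metis diff_self add_0)
qed

lemma maltsev_rep_cond2_not_cond1:
  defines "\<rho> \<equiv> \<lambda>(s, t) (p, q, r). (s * p + s * q, s * q + t * r, s * r) :: 'k::field_char_0 \<times> 'k \<times> 'k"
  shows "maltsev_rep_cond2 (\<lambda>_ _. 0) \<rho>" and "\<not> maltsev_rep_cond1 (\<lambda>_ _. 0) \<rho>"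
proof -
  show "maltsev_rep_cond2 (\<lambda>_ _. 0) \<rho>"
    unfolding maltsev_rep_cond2_def \<rho>_def
    by (auto simp: fun_eq_iff commutator_def zero_prod_def algebra_simps)
  have "(\<rho> 0 - (\<rho> (0, 1) \<circ> anticommutator (\<rho> (1, 0)) (\<rho> (1, 0)))
           + (\<rho> (1, 0) \<circ> anticommutator (\<rho> (1, 0)) (\<rho> (0, 1)))) (0, 0, 1)
       \<noteq> (anticommutator (\<rho> (1, 0)) (\<rho> 0) - (\<rho> (0, 1) \<circ> \<rho> 0) + (\<rho> (1, 0) \<circ> \<rho> 0)) (0, 0, 1)"
    by (simp add: \<rho>_def anticommutator_def zero_prod_def)
  then show "\<not> maltsev_rep_cond1 (\<lambda>_ _. 0) \<rho>"
    unfolding maltsev_rep_cond1_def by metis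
qed

end

theory Submission
  imports Defs "HOL-Analysis.Product_Vector"
begin

text \<open>
  In a Maltsev algebra put \<open>{x, y, z} = 3 [x, y, z]\<close>. Linearising the Maltsev identity shows that every left multiplication
  is a derivation of \<open>{ , , }\<close> (Loos). Since \<open>{x, y, -}\<close> is the combination
  \<open>[L\<^sub>x, L\<^sub>y] + 2 L\<^sub>x\<^sub>\<star>\<^sub>y\<close> of left multiplications and their commutators, it is a derivation too, which
  is (B3); (B2) is another consequence of degree four of the linearised identity. Conditions (1) and
  (2) make the split null extension \<open>M \<oplus> V\<close> a Maltsev algebra, hence a Bol algebra,
  and (R1)--(R33) are its axioms (B1)--(B3) with exactly one argument in \<open>V\<close>.
\<close>

section \<open>Identities of a Maltsev algebra\<close>

context maltsev_algebra
begin

lemma vector_space_scale: "vector_space scale"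
  using bilinear by (auto simp: bilinear_map_def Vector_Spaces.linear_iff)

lemma mul_add_left: "(x + y) \<star> z = x \<star> z + y \<star> z"
  and mul_add_right: "z \<star> (x + y) = z \<star> x + z \<star> y"
  and mul_scale_left: "scale c x \<star> z = scale c (x \<star> z)"
  and mul_scale_right: "z \<star> scale c x = scale c (z \<star> x)"
  using bilinear by (auto simp: bilinear_map_def Vector_Spaces.linear_iff)

lemma mul_zero_left: "0 \<star> z = 0"
  using mul_add_left[of 0 0 z] by simp

lemma mul_zero_right: "z \<star> 0 = 0"
  using mul_add_right[of z 0 0] by simp

lemma mul_minus_left: "(- x) \<star> z = - (x \<star> z)"
  using mul_add_left[of x "- x" z] mul_zero_left[of z]
  by (simp add: minus_unique)

lemma mul_minus_right: "z \<star> (- x) = - (z \<star> x)"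
  using mul_add_right[of z x "- x"] mul_zero_right[of z]
  by (simp add: minus_unique)

lemma mul_diff_left: "(x - y) \<star> z = x \<star> z - y \<star> z"
  using mul_add_left[of x "- y" z] mul_minus_left[of y z] by simp

lemma mul_diff_right: "z \<star> (x - y) = z \<star> x - z \<star> y"
  using mul_add_right[of z x "- y"] mul_minus_right[of z y] by simp

lemmas mul_simps = mul_add_left mul_add_right mul_minus_left mul_minus_right
  mul_diff_left mul_diff_right mul_zero_left mul_zero_right mul_scale_left mul_scale_right

text \<open>Polarisation of the Maltsev identity in its quadratic variable.\<close>
definition maltsev_polar :: "'m \<Rightarrow> 'm \<Rightarrow> 'm \<Rightarrow> 'm \<Rightarrow> 'm" where
  "maltsev_polar a b y z =
     (a \<star> y) \<star> (b \<star> z) + (b \<star> y) \<star> (a \<star> z)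
     - ((a \<star> y) \<star> z) \<star> b - ((b \<star> y) \<star> z) \<star> a
     - ((y \<star> z) \<star> a) \<star> b - ((y \<star> z) \<star> b) \<star> a
     - ((z \<star> a) \<star> b) \<star> y - ((z \<star> b) \<star> a) \<star> y"

text \<open>The defect \<open>f\<close> of the Maltsev identity is homogeneous quadratic in
  \<open>x\<close>, so \<open>f (a + b) - f a - f b\<close> is its polar form, and \<open>f\<close>
  vanishes everywhere.\<close>

lemma maltsev_polar_zero: "maltsev_polar a b y z = 0"
proof -
  define f where "f x = (x \<star> y) \<star> (x \<star> z)
      - (((x \<star> y) \<star> z) \<star> x + ((y \<star> z) \<star> x) \<star> x + ((z \<star> x) \<star> x) \<star> y)" for x
  have "maltsev_polar a b y z = f (a + b) - f a - f b"
    unfolding maltsev_polar_def f_def mul_simps by (simp only: algebra_simps)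
  moreover have "f x = 0" for x
    using maltsev_identity[of x y z] by (simp add: f_def)
  ultimately show ?thesis by simp
qed

text \<open>Three times the Bol bracket; avoiding the factor \<open>1/3\<close> keeps all identities integral.\<close>
definition triple :: "'m \<Rightarrow> 'm \<Rightarrow> 'm \<Rightarrow> 'm" where
  "triple x y z = x \<star> (y \<star> z) - y \<star> (x \<star> z) + (x \<star> y) \<star> z + (x \<star> y) \<star> z"

text \<open>The defect of the derivation rule is an integral combination of polarised Maltsev
  identities. Both (B2) and (B3) rest on this rule.\<close>

lemma mul_triple:
  "w \<star> triple u v z = triple (w \<star> u) v z + triple u (w \<star> v) z + triple u v (w \<star> z)"
proof -
  \<comment> \<open>Ground instances of anticommutativity that put every monomial into normal form;
     the general law would make the simplifier loop.\<close>
  note swap =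
    anticommutative[of v u] anticommutative[of w u] anticommutative[of z u]
    anticommutative[of w v] anticommutative[of z v] anticommutative[of z w]
    anticommutative[of u "p \<star> q" for p q] anticommutative[of v "p \<star> q" for p q]
    anticommutative[of w "p \<star> q" for p q] anticommutative[of z "p \<star> q" for p q]
    anticommutative[of "w \<star> z" "u \<star> v"] anticommutative[of "v \<star> z" "u \<star> w"]
    anticommutative[of "v \<star> w" "u \<star> z"]
  \<comment> \<open>The coefficients here and in the similar identities below solve a linear system over
     the normalised monomials.\<close>
  have "w \<star> triple u v z - triple (w \<star> u) v z - triple u (w \<star> v) z - triple u v (w \<star> z)
      = maltsev_polar v u w z + maltsev_polar v z w u + maltsev_polar v z w u"
    unfolding maltsev_polar_def triple_def
    by (simp add: mul_simps swap algebra_simps)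
  then show ?thesis
    by (simp add: maltsev_polar_zero algebra_simps)
qed

text \<open>Characteristic zero enters here, to cancel the factor 2 in identities that are derived
  in doubled form.\<close>

lemma twofold_eq_zero:
  fixes x :: 'm
  shows "x + x = 0 \<Longrightarrow> x = 0"
proof -
  interpret vector_space scale by (rule vector_space_scale)
  assume "x + x = 0"
  then have "scale (1 + 1) x = 0"
    unfolding scale_left_distrib by simp
  then show ?thesis by simp
qed

text \<open>This is (B2) multiplied by 3, which is why the last product is subtracted three times.
  Twice the defect \<open>?d\<close> is a combination of two polarised Maltsev identities and the
  derivation rule for multiplication by \<open>v\<close>.\<close>

lemma triple_mul:
  "triple x y (u \<star> v) = triple x y u \<star> v + u \<star> triple x y v + triple u v (x \<star> y)
     - (u \<star> v) \<star> (x \<star> y) - (u \<star> v) \<star> (x \<star> y) - (u \<star> v) \<star> (x \<star> y)"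
proof -
  note swap =
    anticommutative[of v u] anticommutative[of x u] anticommutative[of y u]
    anticommutative[of x v] anticommutative[of y v] anticommutative[of y x]
    anticommutative[of u "p \<star> q" for p q] anticommutative[of v "p \<star> q" for p q]
    anticommutative[of x "p \<star> q" for p q] anticommutative[of y "p \<star> q" for p q]
    anticommutative[of "x \<star> y" "u \<star> v"] anticommutative[of "v \<star> y" "u \<star> x"]
    anticommutative[of "v \<star> x" "u \<star> y"]
  let ?d = "triple x y (u \<star> v) - triple x y u \<star> v - u \<star> triple x y v - triple u v (x \<star> y)
     + (u \<star> v) \<star> (x \<star> y) + (u \<star> v) \<star> (x \<star> y) + (u \<star> v) \<star> (x \<star> y)"
  have "?d + ?d = maltsev_polar v x u y - maltsev_polar u x y v
      + (v \<star> triple x y u - triple (v \<star> x) y u - triple x (v \<star> y) u - triple x y (v \<star> u))"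
    unfolding maltsev_polar_def triple_def
    by (simp add: mul_simps swap algebra_simps)
  also have "\<dots> = 0"
    by (simp only: maltsev_polar_zero mul_triple) (simp add: algebra_simps)
  finally have "?d = 0"
    by (rule twofold_eq_zero)
  then show ?thesis
    by (simp only: algebra_simps add_0_left)
qed

text \<open>Anticommutativity suffices: with S the cyclic sum of
  \<open>x \<star> (y \<star> z)\<close>, the three kinds of terms in \<open>triple\<close>
  contribute S, S and -2 S.\<close>

lemma triple_cyclic: "triple x y z + triple y z x + triple z x y = 0"
proof -
  note swap = anticommutative[of y x] anticommutative[of z x] anticommutative[of z y]
    anticommutative[of x "p \<star> q" for p q] anticommutative[of y "p \<star> q" for p q]
    anticommutative[of z "p \<star> q" for p q]
  show ?thesis
    unfolding triple_def by (simp add: mul_simps swap algebra_simps)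
qed

lemma triple_skew: "triple x y z = - triple y x z"
  unfolding triple_def by (simp add: anticommutative[of y x] mul_simps)

lemma triple_triple:
  "triple x y (triple u v w)
     = triple (triple x y u) v w + triple u (triple x y v) w + triple u v (triple x y w)"
proof -
  have add: "triple (a + b) c d = triple a c d + triple b c d"
    "triple c (a + b) d = triple c a d + triple c b d"
    "triple c d (a + b) = triple c d a + triple c d b" for a b c d
    by (simp_all add: triple_def mul_simps algebra_simps)
  have diff: "triple (a - b) c d = triple a c d - triple b c d"
    "triple c (a - b) d = triple c a d - triple c b d"
    "triple c d (a - b) = triple c d a - triple c d b" for a b c d
    by (simp_all add: triple_def mul_simps algebra_simps)
  \<comment> \<open>Here \<open>x\<close> and \<open>y\<close> are fixed, so only brackets beginning
    with \<open>x\<close> and \<open>y\<close> are unfolded into left multiplications. These act on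
    the remaining brackets as derivations by \<open>mul_triple\<close>; the mixed terms, where
    \<open>x\<close> and \<open>y\<close> hit different arguments, cancel in the commutator.\<close>
  have expand: "triple x y a = x \<star> (y \<star> a) - y \<star> (x \<star> a) + (x \<star> y) \<star> a + (x \<star> y) \<star> a" for a
    by (simp add: triple_def)
  show ?thesis
    unfolding expand by (simp add: mul_triple add diff mul_simps algebra_simps)
qed

section \<open>The associated Bol algebra\<close>

lemma assoc_bracket_eq_triple: "assoc_bracket scale (\<star>) x y z = scale (1/3) (triple x y z)"
proof -
  interpret vector_space scale by (rule vector_space_scale)
  have "scale 2 a = a + a" for a
    using scale_left_distrib[of 1 1 a] by simp
  then show ?thesis
    by (simp add: assoc_bracket_def triple_def algebra_simps)
qed

lemma bol_algebra_assoc_bracket: "bol_algebra scale (\<star>) (assoc_bracket scale (\<star>))"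
proof -
  interpret vector_space scale by (rule vector_space_scale)
  \<comment> \<open>For (B2): the product term has coefficient 1 there but 3 in
    \<open>triple_mul\<close>, so it is rewritten as a third of three copies.\<close>
  have third: "a = scale (1/3) (a + a + a)" for a
    using scale_left_distrib[of 1 1 a] scale_left_distrib[of 2 1 a] scale_scale[of "1/3" 3 a] by simp
  have triple_scale: "triple (scale c x) y z = scale c (triple x y z)"
    "triple x (scale c y) z = scale c (triple x y z)"
    "triple x y (scale c z) = scale c (triple x y z)" for c x y z
    by (simp_all add: triple_def mul_simps scale_right_diff_distrib scale_right_distrib)
  have triple_add: "triple (a + b) c d = triple a c d + triple b c d"
    "triple c (a + b) d = triple c a d + triple c b d"
    "triple c d (a + b) = triple c d a + triple c d b" for a b c d
    by (simp_all add: triple_def mul_simps algebra_simps)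
  show ?thesis
  proof (unfold_locales, unfold assoc_bracket_eq_triple)
    show "finite_dim scale" by (rule finite_dim)
    show "bilinear_map scale scale scale (\<star>)" by (rule bilinear)
    show "trilinear_op scale (\<lambda>x y z. scale (1/3) (triple x y z))"
      unfolding trilinear_op_def Vector_Spaces.linear_iff
      by (simp add: vector_space_scale triple_add triple_scale scale_right_distrib mult.commute)
    show "x \<star> y = - (y \<star> x)" for x y by (rule anticommutative)
    show "scale (1/3) (triple x y z) = - scale (1/3) (triple y x z)" for x y z
      by (subst triple_skew) simp
    show "scale (1/3) (triple x y z) + scale (1/3) (triple y z x) + scale (1/3) (triple z x y) = 0"
      for x y z
      by (simp flip: scale_right_distrib add: triple_cyclic)
    show "scale (1/3) (triple x y (u \<star> v))
        = scale (1/3) (triple x y u) \<star> v + u \<star> scale (1/3) (triple x y v)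
          + scale (1/3) (triple u v (x \<star> y)) - (u \<star> v) \<star> (x \<star> y)" for x y u v
      by (subst third[of "(u \<star> v) \<star> (x \<star> y)"])
        (simp add: triple_mul[of x y u v] mul_simps algebra_simps)
    show "scale (1/3) (triple x y (scale (1/3) (triple u v w)))
        = scale (1/3) (triple (scale (1/3) (triple x y u)) v w)
          + scale (1/3) (triple u (scale (1/3) (triple x y v)) w)
          + scale (1/3) (triple u v (scale (1/3) (triple x y w)))" for x y u v w
      by (simp add: triple_scale triple_triple[of x y u v w] scale_right_distrib)
  qed
qed

end


section \<open>The split null extension and the induced representation\<close>

context maltsev_representation
begin

lemma rho_V_linear: "Vector_Spaces.linear scaleV scaleV (\<rho> x)"
  using rho_End[of x] by (simp add: End_def)

lemma vector_space_scaleV: "vector_space scaleV"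
  using rho_V_linear Vector_Spaces.linear_iff by blast

lemma rho_add_right: "\<rho> x (u + v) = \<rho> x u + \<rho> x v"
  and rho_scale_right: "\<rho> x (scaleV c u) = scaleV c (\<rho> x u)"
  using rho_V_linear[of x] by (auto simp: Vector_Spaces.linear_iff)

lemma rho_add_left: "\<rho> (x + y) u = \<rho> x u + \<rho> y u"
  and rho_scale_left: "\<rho> (scaleM c x) u = scaleV c (\<rho> x u)"
  using rho_linear by (auto simp: Vector_Spaces.linear_iff End_scale_def)

lemma rho_zero_left: "\<rho> 0 u = 0"
  using rho_add_left[of 0 0 u] by simp

lemma rho_zero_right: "\<rho> x 0 = 0"
  using rho_add_right[of x 0 0] by simp

lemma rho_minus_left: "\<rho> (- x) u = - \<rho> x u"
  using rho_add_left[of x "- x" u] rho_zero_left[of u] by (simp add: minus_unique)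

lemma rho_minus_right: "\<rho> x (- u) = - \<rho> x u"
  using rho_add_right[of x u "- u"] rho_zero_right[of x] by (simp add: minus_unique)

lemma rho_diff_left: "\<rho> (x - y) u = \<rho> x u - \<rho> y u"
  using rho_add_left[of x "- y" u] rho_minus_left[of y u] by simp

lemma rho_diff_right: "\<rho> x (u - v) = \<rho> x u - \<rho> x v"
  using rho_add_right[of x u "- v"] rho_minus_right[of x v] by simp

lemmas rho_simps = rho_add_left rho_add_right rho_minus_left rho_minus_right
  rho_diff_left rho_diff_right rho_zero_left rho_zero_right rho_scale_left rho_scale_right

text \<open>With everything on one side and evaluated at a vector, instances of the conditions can
  be added up as zero summands; \<open>cond2_pointwise\<close> serves the same purpose.\<close>

lemma cond1_pointwise:
  "\<rho> (x \<star> (y \<star> z)) u - \<rho> z (\<rho> x (\<rho> y u)) - \<rho> z (\<rho> y (\<rho> x u))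
     + \<rho> y (\<rho> x (\<rho> z u)) + \<rho> y (\<rho> z (\<rho> x u))
     - \<rho> x (\<rho> (y \<star> z) u) - \<rho> (y \<star> z) (\<rho> x u) + \<rho> z (\<rho> (x \<star> y) u) - \<rho> y (\<rho> (x \<star> z) u) = 0"
    (is "?c = 0")
proof -
  have "?c = (\<rho> (x \<star> (y \<star> z)) - (\<rho> z \<circ> anticommutator (\<rho> x) (\<rho> y))
         + (\<rho> y \<circ> anticommutator (\<rho> x) (\<rho> z))) u
       - (anticommutator (\<rho> x) (\<rho> (y \<star> z)) - (\<rho> z \<circ> \<rho> (x \<star> y)) + (\<rho> y \<circ> \<rho> (x \<star> z))) u"
    by (simp add: anticommutator_def rho_simps algebra_simps)
  also have "\<dots> = 0"
    by (simp only: cond1[unfolded maltsev_rep_cond1_def, rule_format] diff_self)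
  finally show ?thesis .
qed

lemma cond2_pointwise:
  "\<rho> x (\<rho> y (\<rho> z u)) - \<rho> y (\<rho> x (\<rho> z u)) + \<rho> (x \<star> y) (\<rho> z u)
     - \<rho> z (\<rho> x (\<rho> y u)) + \<rho> z (\<rho> y (\<rho> x u)) - \<rho> z (\<rho> (x \<star> y) u)
     - \<rho> (x \<star> (y \<star> z)) u + \<rho> (y \<star> (x \<star> z)) u - \<rho> ((x \<star> y) \<star> z) u = 0"
    (is "?c = 0")
proof -
  have "?c = commutator (commutator (\<rho> x) (\<rho> y) + \<rho> (x \<star> y)) (\<rho> z) u
       - \<rho> (x \<star> (y \<star> z) - y \<star> (x \<star> z) + (x \<star> y) \<star> z) u"
    by (simp add: commutator_def rho_simps algebra_simps)
  also have "\<dots> = 0"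
    by (simp only: cond2[unfolded maltsev_rep_cond2_def, rule_format] diff_self)
  finally show ?thesis .
qed

text \<open>The identities needed for the extension come out of conditions (1) and (2) multiplied by
  3; characteristic zero removes the factor.\<close>

lemma threefold_eq_zero:
  fixes v :: 'v
  shows "v + v + v = 0 \<Longrightarrow> v = 0"
proof -
  interpret vector_space scaleV by (rule vector_space_scaleV)
  assume "v + v + v = 0"
  then have "scaleV (1 + 1 + 1) v = 0"
    unfolding scale_left_distrib by simp
  then show ?thesis by simp
qed

text \<open>The component in \<open>M\<close> is the Maltsev identity itself. In the component in
  \<open>V\<close> every monomial contains exactly one of the vectors \<open>u\<close>,
  \<open>v\<close>, \<open>w\<close>, so the identity splits into three, one per vector. Three times
  each of them is an integral combination of instances \<open>C1\<close> of condition (1) and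
  \<open>C2\<close> of condition (2).\<close>

lemma maltsev_identity_ext:
  fixes x y z :: "'m \<times> 'v"
  defines "m \<equiv> ext_mul (\<star>) \<rho>"
  shows "m (m x y) (m x z) = m (m (m x y) z) x + m (m (m y z) x) x + m (m (m z x) x) y"
proof -
  obtain a u where x: "x = (a, u)" by (cases x)
  obtain b v where y: "y = (b, v)" by (cases y)
  obtain c w where z: "z = (c, w)" by (cases z)
  define C1 where "C1 p q r t = \<rho> (p \<star> (q \<star> r)) t - \<rho> r (\<rho> p (\<rho> q t)) - \<rho> r (\<rho> q (\<rho> p t))
     + \<rho> q (\<rho> p (\<rho> r t)) + \<rho> q (\<rho> r (\<rho> p t))
     - \<rho> p (\<rho> (q \<star> r) t) - \<rho> (q \<star> r) (\<rho> p t) + \<rho> r (\<rho> (p \<star> q) t) - \<rho> q (\<rho> (p \<star> r) t)"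
    for p q r t
  define C2 where "C2 p q r t = \<rho> p (\<rho> q (\<rho> r t)) - \<rho> q (\<rho> p (\<rho> r t)) + \<rho> (p \<star> q) (\<rho> r t)
     - \<rho> r (\<rho> p (\<rho> q t)) + \<rho> r (\<rho> q (\<rho> p t)) - \<rho> r (\<rho> (p \<star> q) t)
     - \<rho> (p \<star> (q \<star> r)) t + \<rho> (q \<star> (p \<star> r)) t - \<rho> ((p \<star> q) \<star> r) t"
    for p q r t
  have C: "C1 p q r t = 0" "C2 p q r t = 0" for p q r t
    unfolding C1_def C2_def by (rule cond1_pointwise cond2_pointwise)+
  \<comment> \<open>The instances used for \<open>v\<close> and \<open>w\<close> repeat the argument
    \<open>a\<close> and so produce squares \<open>a \<star> a\<close>.\<close>
  have self: "p \<star> p = 0" for p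
    using anticommutative[of p p] twofold_eq_zero[of "p \<star> p"] by (simp add: eq_neg_iff_add_eq_0)
  note swap = anticommutative[of b a] anticommutative[of c a] anticommutative[of c b]
    anticommutative[of a "p \<star> q" for p q] anticommutative[of b "p \<star> q" for p q]
    anticommutative[of c "p \<star> q" for p q] self
  have U: "\<rho> (a \<star> c) (\<rho> b u) - \<rho> (a \<star> b) (\<rho> c u) - \<rho> ((a \<star> b) \<star> c) u - \<rho> ((b \<star> c) \<star> a) u
      + \<rho> a (\<rho> c (\<rho> b u)) - \<rho> b (\<rho> a (\<rho> c u)) + \<rho> a (\<rho> (b \<star> c) u) - \<rho> b (\<rho> (a \<star> c) u) = 0"
    (is "?U = 0")
  proof (rule threefold_eq_zero)
    have "?U + ?U + ?U = C1 b c a u + C1 c a b u + C1 c a b u - C2 c a b u - C2 c a b u - C2 a b c u"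
      unfolding C1_def C2_def by (simp add: swap mul_simps rho_simps algebra_simps)
    then show "?U + ?U + ?U = 0" by (simp only: C) simp
  qed
  have V: "\<rho> ((a \<star> c) \<star> a) v - \<rho> (a \<star> c) (\<rho> a v) - \<rho> a (\<rho> c (\<rho> a v)) + \<rho> a (\<rho> a (\<rho> c v)) = 0"
    (is "?V = 0")
  proof (rule threefold_eq_zero)
    have "?V + ?V + ?V = C2 c a a v + C2 c a a v - C1 a c a v"
      unfolding C1_def C2_def by (simp add: swap mul_simps rho_simps algebra_simps)
    then show "?V + ?V + ?V = 0" by (simp only: C) simp
  qed
  have W: "\<rho> (a \<star> b) (\<rho> a w) + \<rho> a (\<rho> (a \<star> b) w) - \<rho> a (\<rho> a (\<rho> b w)) + \<rho> b (\<rho> a (\<rho> a w)) = 0"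
    (is "?W = 0")
  proof (rule threefold_eq_zero)
    have "?W + ?W + ?W = C1 a b a w + C1 a b a w + C2 a b a w"
      unfolding C1_def C2_def by (simp add: swap mul_simps rho_simps algebra_simps)
    then show "?W + ?W + ?W = 0" by (simp only: C) simp
  qed
  have "snd (m (m x y) (m x z)) - snd (m (m (m x y) z) x + m (m (m y z) x) x + m (m (m z x) x) y)
      = ?U + ?V + ?W"
    unfolding x y z m_def ext_mul_def by (simp add: swap mul_simps rho_simps algebra_simps)
  then have "snd (m (m x y) (m x z)) = snd (m (m (m x y) z) x + m (m (m y z) x) x + m (m (m z x) x) y)"
    by (simp only: U V W) simp
  moreover have "fst (m (m x y) (m x z)) = fst (m (m (m x y) z) x + m (m (m y z) x) x + m (m (m z x) x) y)"
    unfolding x y z m_def ext_mul_def by (simp add: maltsev_identity)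
  ultimately show ?thesis by (simp only: prod_eq_iff)
qed

lemma finite_dim_ext: "finite_dim (ext_scale scaleM scaleV)"
proof -
  obtain B1 B2 where "finite_dimensional_vector_space scaleM B1" "finite_dimensional_vector_space scaleV B2"
    using finite_dim finite_dimV by (auto simp: finite_dim_def)
  then interpret finite_dimensional_vector_space_prod scaleM scaleV B1 B2
    by (simp add: finite_dimensional_vector_space_prod_def finite_dimensional_vector_space_pair_def
        vector_space_prod_def vector_space_pair_def finite_dimensional_vector_space_def)
  \<comment> \<open>Inside this interpretation \<open>scale\<close> is the componentwise scaling of
    the product space, whose finite basis is supplied by the product locale.\<close>
  have "ext_scale scaleM scaleV = scale"
    by (simp add: fun_eq_iff ext_scale_def scale_def)
  then show ?thesis
    using p.finite_dimensional_vector_space_axioms by (auto simp: finite_dim_def)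
qed

lemma maltsev_algebra_ext: "maltsev_algebra (ext_scale scaleM scaleV) (ext_mul (\<star>) \<rho>)"
proof
  interpret V: vector_space scaleV by (rule vector_space_scaleV)
  show "finite_dim (ext_scale scaleM scaleV)" by (rule finite_dim_ext)
  then have "vector_space (ext_scale scaleM scaleV)"
    by (auto simp: finite_dim_def finite_dimensional_vector_space_def)
  then show "bilinear_map (ext_scale scaleM scaleV) (ext_scale scaleM scaleV)
      (ext_scale scaleM scaleV) (ext_mul (\<star>) \<rho>)"
    unfolding bilinear_map_def Vector_Spaces.linear_iff
    by (simp add: ext_mul_def ext_scale_def mul_simps rho_simps V.scale_right_diff_distrib)
  show "ext_mul (\<star>) \<rho> x y = - ext_mul (\<star>) \<rho> y x" for x y
    using anticommutative[of "fst x" "fst y"] by (simp add: ext_mul_def uminus_prod_def)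
qed (rule maltsev_identity_ext)

text \<open>Elements of \<open>M\<close> enter the extension as \<open>(x, 0)\<close> and vectors as
  \<open>(0, v)\<close>. (R1) is (B1) with the vector last; (R21) and (R22) are (B2) with the vector
  in the fourth and second argument; (R31), (R32) and (R33) are (B3) with the vector in the fifth,
  third and second argument.\<close>

lemma bol_representation_induced:
  "bol_representation scaleM (\<star>) (assoc_bracket scaleM (\<star>)) scaleV \<rho>
     (induced_D scaleV (\<star>) \<rho>) (induced_theta scaleV (\<star>) \<rho>)"
proof -
  let ?D = "induced_D scaleV (\<star>) \<rho>" and ?\<theta> = "induced_theta scaleV (\<star>) \<rho>"
  interpret V: vector_space scaleV by (rule vector_space_scaleV)
  interpret M: bol_algebra scaleM "(\<star>)" "assoc_bracket scaleM (\<star>)"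
    by (rule bol_algebra_assoc_bracket)
  define B where "B = assoc_bracket (ext_scale scaleM scaleV) (ext_mul (\<star>) \<rho>)"
  interpret E: bol_algebra "ext_scale scaleM scaleV" "ext_mul (\<star>) \<rho>" B
    unfolding B_def by (rule maltsev_algebra.bol_algebra_assoc_bracket[OF maltsev_algebra_ext])
  note ext_br = assoc_bracket_ext[folded B_def]
  \<comment> \<open>Moving the vector from the middle to the first slot by (B02) costs a
    sign.\<close>
  have ext_\<theta>: "B (x, 0) (0, v) (y, 0) = (0, - ?\<theta> x y v)" for x y v
    using E.B02[of "(x, 0)" "(0, v)" "(y, 0)"] by (simp add: ext_br)
  have ext_mul: "ext_mul (\<star>) \<rho> (x, 0) (y, 0) = (x \<star> y, 0)"
    "ext_mul (\<star>) \<rho> (x, 0) (0, v) = (0, \<rho> x v)"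
    "ext_mul (\<star>) \<rho> (0, v) (x, 0) = (0, - \<rho> x v)" for x y v
    by (simp_all add: ext_mul_def mul_simps rho_simps)
  have End: "vector_space (End_scale scaleV)"
    using rho_linear by (simp add: Vector_Spaces.linear_iff)
  note defs = induced_D_def induced_theta_def End_scale_def commutator_def
  \<comment> \<open>In (R33) the inner brackets yield vectors with the sign from
    \<open>ext_\<theta>\<close>, which must be pulled through the outer maps.\<close>
  have minus: "?D x y (- v) = - ?D x y v" "?\<theta> x y (- v) = - ?\<theta> x y v" for x y v
    by (simp_all add: defs rho_simps V.scale_right_diff_distrib V.scale_right_distrib)
  have bilin: "?D (x + x') y v = ?D x y v + ?D x' y v" "?D x (y + y') v = ?D x y v + ?D x y' v"
    "?D (scaleM c x) y v = scaleV c (?D x y v)" "?D x (scaleM c y) v = scaleV c (?D x y v)"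
    "?\<theta> (x + x') y v = ?\<theta> x y v + ?\<theta> x' y v" "?\<theta> x (y + y') v = ?\<theta> x y v + ?\<theta> x y' v"
    "?\<theta> (scaleM c x) y v = scaleV c (?\<theta> x y v)" "?\<theta> x (scaleM c y) v = scaleV c (?\<theta> x y v)"
    for x x' y y' v c
    by (simp_all add: defs mul_simps rho_simps algebra_simps)
  show ?thesis
  proof (rule bol_representation.intro[OF M.bol_algebra_axioms bol_representation_axioms.intro])
    show "finite_dim scaleV" by (rule finite_dimV)
    show "\<rho> x \<in> End scaleV" for x by (rule rho_End)
    show "?D x y \<in> End scaleV" for x y
      unfolding End_def Vector_Spaces.linear_iff
      by (simp add: vector_space_scaleV defs rho_simps algebra_simps)
    show "?\<theta> x y \<in> End scaleV" for x y
      unfolding End_def Vector_Spaces.linear_iff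
      by (simp add: vector_space_scaleV defs rho_simps algebra_simps)
    show "Vector_Spaces.linear scaleM (End_scale scaleV) \<rho>" by (rule rho_linear)
    show "bilinear_map scaleM scaleM (End_scale scaleV) ?D"
      unfolding bilinear_map_def Vector_Spaces.linear_iff
      by (intro conjI allI ext vector_space_scale End) (simp_all only: End_scale_def bilin plus_fun_apply)
    show "bilinear_map scaleM scaleM (End_scale scaleV) ?\<theta>"
      unfolding bilinear_map_def Vector_Spaces.linear_iff
      by (intro conjI allI ext vector_space_scale End) (simp_all only: End_scale_def bilin plus_fun_apply)
    show "?D x1 x2 + ?\<theta> x1 x2 - ?\<theta> x2 x1 = 0" for x1 x2
    proof (rule ext)
      fix v
      show "(?D x1 x2 + ?\<theta> x1 x2 - ?\<theta> x2 x1) v = 0 v"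
        using E.B1[of "(x1, 0)" "(x2, 0)" "(0, v)"] by (simp add: ext_br ext_\<theta> zero_prod_def algebra_simps)
    qed
    show "commutator (?D x1 x2) (\<rho> y1)
        = \<rho> (assoc_bracket scaleM (\<star>) x1 x2 y1) - ?\<theta> y1 (x1 \<star> x2) + (\<rho> (x1 \<star> x2) \<circ> \<rho> y1)"
      for x1 x2 y1
    proof (rule ext)
      fix v
      show "commutator (?D x1 x2) (\<rho> y1) v
        = (\<rho> (assoc_bracket scaleM (\<star>) x1 x2 y1) - ?\<theta> y1 (x1 \<star> x2) + (\<rho> (x1 \<star> x2) \<circ> \<rho> y1)) v"
        using E.B2[of "(x1, 0)" "(x2, 0)" "(y1, 0)" "(0, v)"]
        by (simp add: ext_br ext_\<theta> ext_mul commutator_def)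
    qed
    show "?\<theta> x1 (y1 \<star> y2)
        = (\<rho> y1 \<circ> ?\<theta> x1 y2) - (\<rho> y2 \<circ> ?\<theta> x1 y1) - ((?D y1 y2 - \<rho> (y1 \<star> y2)) \<circ> \<rho> x1)"
      for x1 y1 y2
    proof (rule ext)
      fix v
      \<comment> \<open>Since the vector sits in the second slot, (B2) yields the negative of (R22);
        the sign is removed at the end.\<close>
      have "- ?\<theta> x1 (y1 \<star> y2) v = \<rho> y2 (?\<theta> x1 y1 v) - \<rho> y1 (?\<theta> x1 y2 v) + ?D y1 y2 (\<rho> x1 v)
          - \<rho> (y1 \<star> y2) (\<rho> x1 v)"
        using E.B2[of "(x1, 0)" "(0, v)" "(y1, 0)" "(y2, 0)"]
        by (simp add: ext_br ext_\<theta> ext_mul rho_simps)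
      then show "?\<theta> x1 (y1 \<star> y2) v
          = ((\<rho> y1 \<circ> ?\<theta> x1 y2) - (\<rho> y2 \<circ> ?\<theta> x1 y1) - ((?D y1 y2 - \<rho> (y1 \<star> y2)) \<circ> \<rho> x1)) v"
        by (subst neg_equal_iff_equal[symmetric]) simp
    qed
    show "commutator (?D x1 x2) (?D y1 y2)
        = ?D (assoc_bracket scaleM (\<star>) x1 x2 y1) y2 + ?D y1 (assoc_bracket scaleM (\<star>) x1 x2 y2)"
      for x1 x2 y1 y2
    proof (rule ext)
      fix v
      show "commutator (?D x1 x2) (?D y1 y2) v
        = (?D (assoc_bracket scaleM (\<star>) x1 x2 y1) y2 + ?D y1 (assoc_bracket scaleM (\<star>) x1 x2 y2)) v"
        using E.B3[of "(x1, 0)" "(x2, 0)" "(y1, 0)" "(y2, 0)" "(0, v)"]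
        by (simp add: ext_br commutator_def)
    qed
    show "commutator (?D x1 x2) (?\<theta> y1 y2)
        = ?\<theta> (assoc_bracket scaleM (\<star>) x1 x2 y1) y2 + ?\<theta> y1 (assoc_bracket scaleM (\<star>) x1 x2 y2)"
      for x1 x2 y1 y2
    proof (rule ext)
      fix v
      show "commutator (?D x1 x2) (?\<theta> y1 y2) v
        = (?\<theta> (assoc_bracket scaleM (\<star>) x1 x2 y1) y2 + ?\<theta> y1 (assoc_bracket scaleM (\<star>) x1 x2 y2)) v"
        using E.B3[of "(x1, 0)" "(x2, 0)" "(0, v)" "(y1, 0)" "(y2, 0)"]
        by (simp add: ext_br commutator_def)
    qed
    show "?\<theta> x1 (assoc_bracket scaleM (\<star>) y1 y2 y3)
        = (?\<theta> y2 y3 \<circ> ?\<theta> x1 y1) - (?\<theta> y1 y3 \<circ> ?\<theta> x1 y2) + (?D y1 y2 \<circ> ?\<theta> x1 y3)"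
      for x1 y1 y2 y3
    proof (rule ext)
      fix v
      \<comment> \<open>As for (R22), (B3) with the vector in the second slot yields the negated
        equation.\<close>
      have "- ?\<theta> x1 (assoc_bracket scaleM (\<star>) y1 y2 y3) v
          = - ?\<theta> y2 y3 (?\<theta> x1 y1 v) + ?\<theta> y1 y3 (?\<theta> x1 y2 v) - ?D y1 y2 (?\<theta> x1 y3 v)"
        using E.B3[of "(x1, 0)" "(0, v)" "(y1, 0)" "(y2, 0)" "(y3, 0)"]
        by (simp add: ext_br ext_\<theta> minus)
      then show "?\<theta> x1 (assoc_bracket scaleM (\<star>) y1 y2 y3) v
          = ((?\<theta> y2 y3 \<circ> ?\<theta> x1 y1) - (?\<theta> y1 y3 \<circ> ?\<theta> x1 y2) + (?D y1 y2 \<circ> ?\<theta> x1 y3)) v"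
        by (subst neg_equal_iff_equal[symmetric]) simp
    qed
  qed
qed

end

theorem proposition2p7:
  fixes scaleM :: "'k::field_char_0 \<Rightarrow> 'm::ab_group_add \<Rightarrow> 'm"
    and mul :: "'m \<Rightarrow> 'm \<Rightarrow> 'm"
    and scaleV :: "'k \<Rightarrow> 'v::ab_group_add \<Rightarrow> 'v"
    and \<rho> :: "'m \<Rightarrow> 'v \<Rightarrow> 'v"
  assumes "maltsev_algebra scaleM mul"
    and "maltsev_representation scaleM mul scaleV \<rho>"
  shows "bol_representation scaleM mul (assoc_bracket scaleM mul) scaleV \<rho>
           (induced_D scaleV mul \<rho>) (induced_theta scaleV mul \<rho>)"
  using assms(2) by (rule maltsev_representation.bol_representation_induced)

end
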